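(* $$-\frac{8}{\pi^2} = \sum_{k=0}^{\infty}\left(-\frac{1}{1024}\right)^{k}\frac{\left(-\frac12\right)_k^3\left(\frac12\right)_k^2}{(1)_k^5}\,\big(6560k^5-528k^4+176k^3+8k^2-6k-1\big).$$
   Context: The Pochhammer symbol is $(x)_k := \frac{\Gamma(x+k)}{\Gamma(x)}$, i.e. $(x)_k = x(x+1)\cdots(x+k-1)$ for integers $k\ge 0$; $(x)_k^m$ means $\big((x)_k\big)^m$. *)

theory Defs
  imports "HOL-Analysis.Analysis"
begin

end

theory Submission
  imports Defs "HOL-Real_Asymp.Real_Asymp"
begin

text \<open>
  Since \<open>pochhammer (-1/2) n = - pochhammer (1/2) n / (2 n - 1)\<close>, the series is a rational variant of
  Guillera's series with \<open>u n = (-1/1024) ^ n * (pochhammer (1/2) n / n!) ^ 5\<close>, namely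
  \<open>(\<Sum>n. u n * (820 n^2 + 180 n + 13)) = 128 / pi^2\<close>.

  The proof is by creative telescoping in the plane. The functions \<open>wz_F\<close> and \<open>wz_G\<close> satisfy
  \<open>F (n+1) k - F n k = G n (k+1) - G n k\<close> (lemma \<open>wz_pair\<close>), so they are the increments of one
  potential on the lattice: \<open>G n k\<close> along the step from \<open>(n, k)\<close> to \<open>(n+1, k)\<close>, and \<open>F n k\<close> along
  the step from \<open>(n, k)\<close> to \<open>(n, k+1)\<close>. Compare two ways of going from \<open>(0, 0)\<close> to \<open>(N, N)\<close>.
  The staircase along the diagonal collects
  \<open>F n n + G n (n+1) = u n * (820 n^2 + 180 n + 13) / 16\<close> for \<open>n < N\<close>. The path that first goes up
  the axis \<open>n = 0\<close>, where \<open>F\<close> vanishes, and then along the row \<open>k = N\<close> collects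
  \<open>\<Sum>n<N. G n N\<close>. In this row sum the entry with \<open>n = 0\<close> tends to \<open>8 / pi^2\<close> by Wallis' product,
  while the other \<open>N - 1\<close> entries are \<open>O (1 / N^2)\<close> uniformly in \<open>n\<close>, so that their sum tends to \<open>0\<close>
  (lemma \<open>sum_wz_G_tendsto\<close>).

  The summand of the theorem is minus the diagonal increment up to the difference of the sequence
  \<open>correction\<close> (lemma \<open>series_term_telescope\<close>), which vanishes at \<open>0\<close> and at infinity.
\<close>

section \<open>The WZ pair\<close>

text \<open>
  At \<open>k = 0\<close> this is the factor \<open>(-1/4) ^ n * (pochhammer (1/2) n / n!) ^ 5\<close> of Guillera's series
  \<open>(\<Sum>n. (-1/4) ^ n * (pochhammer (1/2) n / n!) ^ 5 * (20 n^2 + 8 n + 1)) = 8 / pi^2\<close>. The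
  dependence on \<open>k\<close> is chosen such that, for fixed \<open>n\<close> and with \<open>a = n + 1/2\<close>, \<open>wz_F n k\<close> is
  proportional to \<open>(a + 2 k) * (pochhammer (1/2) k / pochhammer (1 + a - 1/2) k) ^ 4\<close>, the summand
  of a well-poised hypergeometric series of Dougall's type.
\<close>

definition wz_base :: "nat \<Rightarrow> nat \<Rightarrow> real" where
  "wz_base n k = (- 1) ^ n * pochhammer (1/2) n ^ 6 * pochhammer (1/2) k ^ 4
     / (fact (2 * n) * fact (n + k) ^ 4)"

definition wz_G :: "nat \<Rightarrow> nat \<Rightarrow> real" where
  "wz_G n k = wz_base n k *
     (20 * real n ^ 2 + 8 * real n + 1 + 24 * real k * real n + 8 * real k ^ 2 + 4 * real k)"

definition wz_F :: "nat \<Rightarrow> nat \<Rightarrow> real" where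
  "wz_F n k = wz_base n k * (8 * real n * (2 * real n + 4 * real k + 1))"

lemma wz_base_Suc_left:
  "wz_base (Suc n) k =
     - wz_base n k * (real n + 1/2) ^ 5 / (4 * (real n + 1) * (real n + real k + 1) ^ 4)"
proof -
  have "(2 * real n + 1) * (2 * real n + 2) = 4 * (real n + 1) * (real n + 1/2)"
    by (simp add: algebra_simps)
  moreover have "fact (2 * Suc n) = (2 * real n + 1) * (2 * real n + 2) * (fact (2 * n) :: real)"
    by (simp add: algebra_simps)
  ultimately have f: "fact (2 * Suc n) = (4 * (real n + 1) * (real n + 1/2)) * (fact (2 * n) :: real)"
    by metis
  have g: "fact (Suc n + k) = (real n + real k + 1) * (fact (n + k) :: real)"
    by (simp add: algebra_simps)
  have p: "pochhammer (1/2) (Suc n) = pochhammer (1/2) n * (real n + 1/2)"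
    by (simp add: pochhammer_Suc algebra_simps)
  have nz: "real n + 1/2 \<noteq> 0" by linarith
  have cancel: "s * (P * z ^ 6) * K / (4 * m * z * f * (R * g)) = s * P * K / (f * g) * z ^ 5 / (4 * m * R)"
    if "z \<noteq> 0" for s P z K m f R g :: real
  proof -
    have "z ^ 6 = z ^ 5 * z" by (simp add: eval_nat_numeral)
    then show ?thesis using that by (simp add: mult_ac)
  qed
  show ?thesis
    unfolding wz_base_def f g p power_mult_distrib cancel[OF nz] by simp
qed

lemma wz_base_Suc_right:
  "wz_base n (Suc k) = wz_base n k * (real k + 1/2) ^ 4 / (real n + real k + 1) ^ 4"
proof -
  have g: "fact (n + Suc k) = (real n + real k + 1) * (fact (n + k) :: real)"
    by (simp add: algebra_simps)
  have p: "pochhammer (1/2) (Suc k) = pochhammer (1/2) k * (real k + 1/2)"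
    by (simp add: pochhammer_Suc algebra_simps)
  show ?thesis
    unfolding wz_base_def g p power_mult_distrib by (simp add: field_simps)
qed

text \<open>Both sides are \<open>wz_base n k\<close> times a rational function; the identity is then polynomial.\<close>

lemma wz_pair: "wz_F (Suc n) k - wz_F n k = wz_G n (Suc k) - wz_G n k"
proof -
  define x y where "x = real n" and "y = real k"
  define D where "D = (x + y + 1) ^ 4"
  have D: "D \<noteq> 0" unfolding D_def x_def y_def by (simp add: add_nonneg_eq_0_iff)
  have x1: "x + 1 \<noteq> 0" unfolding x_def by linarith
  have "c / (4 * m * D) * (8 * m * w) = 2 * c * w / D" if "m \<noteq> 0" for c m w :: real
    using that D by (simp add: field_simps)
  then have "(x + 1/2) ^ 5 / (4 * (x + 1) * D) * (8 * (x + 1) * (2 * x + 4 * y + 3))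
        = 2 * (x + 1/2) ^ 5 * (2 * x + 4 * y + 3) / D"
    using x1 by blast
  moreover have "- (2 * (x + 1/2) ^ 5 * (2 * x + 4 * y + 3)) - 8 * x * (2 * x + 4 * y + 1) * D
      = (y + 1/2) ^ 4 * (20 * x ^ 2 + 8 * x + 1 + 24 * (y + 1) * x + 8 * (y + 1) ^ 2 + 4 * (y + 1))
        - (20 * x ^ 2 + 8 * x + 1 + 24 * y * x + 8 * y ^ 2 + 4 * y) * D"
    unfolding D_def by (simp add: field_simps, algebra)
  ultimately have "- ((x + 1/2) ^ 5 / (4 * (x + 1) * D)) * (8 * (x + 1) * (2 * x + 4 * y + 3))
        - 8 * x * (2 * x + 4 * y + 1)
      = (y + 1/2) ^ 4 / D * (20 * x ^ 2 + 8 * x + 1 + 24 * (y + 1) * x + 8 * (y + 1) ^ 2 + 4 * (y + 1))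
        - (20 * x ^ 2 + 8 * x + 1 + 24 * y * x + 8 * y ^ 2 + 4 * y)"
    using D by (simp add: field_simps)
  then have "wz_base n k * (- ((x + 1/2) ^ 5 / (4 * (x + 1) * D)) * (8 * (x + 1) * (2 * x + 4 * y + 3)))
        - wz_base n k * (8 * x * (2 * x + 4 * y + 1))
      = wz_base n k * ((y + 1/2) ^ 4 / D * (20 * x ^ 2 + 8 * x + 1 + 24 * (y + 1) * x + 8 * (y + 1) ^ 2 + 4 * (y + 1)))
        - wz_base n k * (20 * x ^ 2 + 8 * x + 1 + 24 * y * x + 8 * y ^ 2 + 4 * y)"
    by (simp only: flip: right_diff_distrib)
  moreover have "wz_F (Suc n) k
      = wz_base n k * (- ((x + 1/2) ^ 5 / (4 * (x + 1) * D)) * (8 * (x + 1) * (2 * x + 4 * y + 3)))"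
  proof -
    have "8 * real (Suc n) * (2 * real (Suc n) + 4 * real k + 1) = 8 * (x + 1) * (2 * x + 4 * y + 3)"
      by (simp add: x_def y_def algebra_simps)
    moreover have "wz_base (Suc n) k = wz_base n k * (- ((x + 1/2) ^ 5 / (4 * (x + 1) * D)))"
      by (simp add: wz_base_Suc_left x_def y_def D_def)
    ultimately show ?thesis by (simp only: wz_F_def mult.assoc)
  qed
  moreover have "wz_G n (Suc k)
      = wz_base n k * ((y + 1/2) ^ 4 / D * (20 * x ^ 2 + 8 * x + 1 + 24 * (y + 1) * x + 8 * (y + 1) ^ 2 + 4 * (y + 1)))"
    by (simp add: wz_G_def wz_base_Suc_right x_def y_def D_def add.commute)
  ultimately show ?thesis
    by (simp add: wz_F_def wz_G_def x_def y_def)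
qed

text \<open>
  Moving a row sum up by one costs only the increment at its right end, because the increment
  \<open>wz_F 0 k\<close> at its left end is zero.
\<close>

lemma sum_wz_G_Suc: "(\<Sum>n<m. wz_G n (Suc k)) = (\<Sum>n<m. wz_G n k) + wz_F m k"
proof (induction m)
  case 0
  then show ?case by (simp add: wz_F_def)
next
  case (Suc m)
  then show ?case using wz_pair[of m k] by simp
qed

section \<open>The series as a diagonal of the WZ pair\<close>

lemma wz_base_diag:
  "wz_base n n = (- 1 / 1024) ^ n * pochhammer (1/2) n ^ 5 / fact n ^ 5"
proof -
  have "fact (2 * n) = 4 ^ n * pochhammer (1/2) n * (fact n :: real)"
    using fact_double[of n, where 'a = real] by (simp add: power_mult)
  then have "wz_base n n = (- 1) ^ n * pochhammer (1/2) n ^ 10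
      / (4 ^ n * pochhammer (1/2) n * fact n) ^ 5"
    by (simp add: wz_base_def mult_2 flip: power_add power_Suc2 power_Suc)
  moreover have "((4::real) ^ n) ^ 5 = 1024 ^ n"
    using power_mult[of "4::real" 5 n] power_mult[of "4::real" n 5] by (simp add: mult.commute)
  ultimately have "wz_base n n = (- 1) ^ n * pochhammer (1/2) n ^ 10
      / (1024 ^ n * pochhammer (1/2) n ^ 5 * fact n ^ 5)"
    by (simp only: power_mult_distrib)
  moreover have "pochhammer (1/2::real) n \<noteq> 0"
    using pochhammer_pos[of "1/2::real" n] by simp
  moreover have "s * (q * q) / (c * q * f) = s / c * q / f" if "q \<noteq> 0" for s q c f :: real
    using that by simp
  moreover have "p ^ 10 = p ^ 5 * p ^ 5" for p :: real
    by (simp flip: power_add)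
  moreover have "(- 1 / 1024 :: real) ^ n = (- 1) ^ n / 1024 ^ n"
    by (rule power_divide)
  ultimately show ?thesis by (metis power_not_zero)
qed

lemma two_times_minus_1_neq_0: "2 * real n - 1 \<noteq> 0"
  by (metis diff_eq_eq add_0 of_nat_1 of_nat_eq_iff of_nat_mult of_nat_numeral even_mult_iff even_numeral odd_one)

lemma pochhammer_minus_half:
  "pochhammer (- 1/2 :: real) n = - pochhammer (1/2) n / (2 * real n - 1)"
proof (induction n)
  case 0
  then show ?case by simp
next
  case (Suc n)
  show ?case
    unfolding pochhammer_Suc Suc using two_times_minus_1_neq_0[of n] by (simp add: field_simps)
qed

definition series_term :: "nat \<Rightarrow> real" where
  "series_term k = (- 1 / 1024 :: real) ^ k
            * ((pochhammer (- 1 / 2) k) ^ 3 * (pochhammer (1 / 2) k) ^ 2 / (pochhammer 1 k) ^ 5)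
            * (6560 * real k ^ 5 - 528 * real k ^ 4 + 176 * real k ^ 3
               + 8 * real k ^ 2 - 6 * real k - 1)"

text \<open>
  Write \<open>P n\<close> for the quintic factor of the series. The sequence has to solve
  \<open>correction (n+1) - correction n = u n * ((820 n^2 + 180 n + 13) / 16 - P n / (2 n - 1) ^ 3)\<close>.
  As \<open>u (n+1) / u n = - (2 n + 1) ^ 5 / (32768 * (n + 1) ^ 5)\<close>, the form
  \<open>c * u n * n ^ 5 / (2 n - 1) ^ 3\<close> makes the left side a rational multiple of \<open>u n\<close> with
  denominator \<open>(2 n - 1) ^ 3\<close>; comparing leading coefficients gives
  \<open>c * (1 + 1/1024) = 6560 - 410\<close>, that is \<open>c = 6144\<close>.
\<close>

definition correction :: "nat \<Rightarrow> real" where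
  "correction n = 6144 * wz_base n n * real n ^ 5 / (2 * real n - 1) ^ 3"

lemma series_term_telescope:
  "series_term n = correction (Suc n) - correction n - (wz_F n n + wz_G n (Suc n))"
proof -
  define x where "x = real n"
  define u where "u = wz_base n n"
  define q where "q = 2 * x - 1"
  have q: "q \<noteq> 0"
    unfolding q_def x_def by (rule two_times_minus_1_neq_0)
  have x1: "x + 1 \<noteq> 0" "2 * x + 1 \<noteq> 0" unfolding x_def by linarith+
  have t: "series_term n = - u * (6560 * x ^ 5 - 528 * x ^ 4 + 176 * x ^ 3 + 8 * x ^ 2 - 6 * x - 1) / q ^ 3"
    unfolding series_term_def u_def wz_base_diag pochhammer_minus_half pochhammer_fact[symmetric] x_def q_def
    by (simp add: power_divide flip: power_add)
  have f: "wz_F n n = u * (8 * x * (6 * x + 1))"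
    by (simp add: wz_F_def u_def x_def)
  have "wz_base n (Suc n) = u * (x + 1/2) ^ 4 / (2 * (x + 1/2)) ^ 4"
    unfolding wz_base_Suc_right u_def x_def by (simp add: algebra_simps)
  then have right: "wz_base n (Suc n) = u / 16"
    using x1 by (simp only: power_mult_distrib) (simp add: field_simps)
  have "20 * real n ^ 2 + 8 * real n + 1 + 24 * real (Suc n) * real n + 8 * real (Suc n) ^ 2
      + 4 * real (Suc n) = 13 * (2 * x + 1) ^ 2"
    unfolding x_def by (simp add: algebra_simps power2_eq_square)
  then have g: "wz_G n (Suc n) = u * (13 * (2 * x + 1) ^ 2) / 16"
    unfolding wz_G_def right by simp
  have "wz_base (Suc n) (Suc n) = - u * (2 * x + 1) ^ 5 / (32768 * (x + 1) ^ 5)"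
  proof -
    have "x + real (Suc n) + 1 = 2 * (x + 1)" "x + 1/2 = (2 * x + 1) / 2"
      by (simp_all add: x_def)
    then have "wz_base (Suc n) (Suc n)
        = - (u / 16) * ((2 * x + 1) / 2) ^ 5 / (4 * (x + 1) * (2 * (x + 1)) ^ 4)"
      using wz_base_Suc_left[of n "Suc n"] unfolding right x_def[symmetric] by (simp only:)
    also have "\<dots> = - u * (2 * x + 1) ^ 5 / (32768 * ((x + 1) * (x + 1) ^ 4))"
      by (simp only: power_mult_distrib power_divide) simp
    also have "(x + 1) * (x + 1) ^ 4 = (x + 1) ^ 5"
      by (simp add: eval_nat_numeral)
    finally show ?thesis .
  qed
  moreover have "real (Suc n) = x + 1" "2 * real (Suc n) - 1 = 2 * x + 1"
    by (simp_all add: x_def)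
  ultimately have "correction (Suc n)
      = 6144 * (- u * (2 * x + 1) ^ 5 / (32768 * (x + 1) ^ 5)) * (x + 1) ^ 5 / (2 * x + 1) ^ 3"
    unfolding correction_def by (simp only:)
  moreover have "6144 * (- u * a ^ 5 / (32768 * b ^ 5)) * b ^ 5 / a ^ 3 = - 3 / 16 * u * a ^ 2"
    if "a \<noteq> 0" "b \<noteq> 0" for a b :: real
    using that by (simp add: eval_nat_numeral)
  ultimately have h: "correction (Suc n) = - 3 / 16 * u * (2 * x + 1) ^ 2"
    using x1 by metis
  have h0: "correction n = 6144 * u * x ^ 5 / q ^ 3"
    by (simp add: correction_def u_def x_def q_def)
  have poly: "- (6560 * x ^ 5 - 528 * x ^ 4 + 176 * x ^ 3 + 8 * x ^ 2 - 6 * x - 1)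
      = - 3 / 16 * (2 * x + 1) ^ 2 * q ^ 3 - 6144 * x ^ 5
        - (8 * x * (6 * x + 1) + 13 * (2 * x + 1) ^ 2 / 16) * q ^ 3"
    unfolding q_def by (simp add: field_simps, algebra)
  have frac: "p / w = A - B / w - C" if "p = A * w - B - C * w" "w \<noteq> 0" for p w A B C :: real
    using that by (simp add: field_simps)
  have "- (6560 * x ^ 5 - 528 * x ^ 4 + 176 * x ^ 3 + 8 * x ^ 2 - 6 * x - 1) / q ^ 3
      = - 3 / 16 * (2 * x + 1) ^ 2 - 6144 * x ^ 5 / q ^ 3
        - (8 * x * (6 * x + 1) + 13 * (2 * x + 1) ^ 2 / 16)"
    by (rule frac[OF poly power_not_zero[OF q]])
  then have "u * (- (6560 * x ^ 5 - 528 * x ^ 4 + 176 * x ^ 3 + 8 * x ^ 2 - 6 * x - 1) / q ^ 3)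
      = u * (- 3 / 16 * (2 * x + 1) ^ 2 - 6144 * x ^ 5 / q ^ 3
        - (8 * x * (6 * x + 1) + 13 * (2 * x + 1) ^ 2 / 16))"
    by simp
  then show ?thesis
    unfolding t f g h h0 by (simp add: algebra_simps)
qed

text \<open>The two lattice paths from \<open>(0, 0)\<close> to \<open>(N, N)\<close>, compared by induction on \<open>N\<close>.\<close>

lemma sum_series_term:
  "(\<Sum>n<N. series_term n) = correction N - (\<Sum>n<N. wz_G n N)"
proof (induction N)
  case 0
  then show ?case by (simp add: correction_def)
next
  case (Suc N)
  then show ?case
    using sum_wz_G_Suc[of N N] by (simp add: series_term_telescope)
qed

section \<open>Limits\<close>

lemma pochhammer_half_le_fact: "pochhammer (1/2 :: real) k \<le> fact k"
proof (induction k)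
  case (Suc k)
  have "pochhammer (1/2 :: real) k * (1/2 + real k) \<le> fact k * (1 + real k)"
    using Suc by (intro mult_mono) auto
  then show ?case by (simp add: pochhammer_Suc mult.commute)
qed simp

lemma abs_wz_base_0_le: "\<bar>wz_base 0 k\<bar> \<le> 1"
proof -
  have "pochhammer (1/2 :: real) k ^ 4 \<le> fact k ^ 4"
    by (intro power_mono pochhammer_half_le_fact pochhammer_nonneg) auto
  moreover have "pochhammer (1/2 :: real) k \<ge> 0" by (intro pochhammer_nonneg) auto
  ultimately show ?thesis by (simp add: wz_base_def)
qed

text \<open>
  The step from \<open>n = 0\<close> to \<open>n = 1\<close> supplies the factor \<open>1 / (k + 1) ^ 4\<close>, which beats the quadratic
  growth of the polynomial in \<open>wz_G\<close>; later steps do not increase the absolute value.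
\<close>

lemma abs_wz_base_Suc_le: "\<bar>wz_base (Suc n) k\<bar> \<le> 1 / (real k + 1) ^ 4"
proof (induction n)
  case 0
  have "\<bar>wz_base (Suc 0) k\<bar> = \<bar>wz_base 0 k\<bar> * (1/128) / (real k + 1) ^ 4"
    by (simp add: wz_base_Suc_left abs_mult power_divide)
  also have "\<dots> \<le> 1 / (real k + 1) ^ 4"
    using abs_wz_base_0_le[of k] by (intro divide_right_mono) auto
  finally show ?case .
next
  case (Suc n)
  define x where "x = real (Suc n)"
  have x: "x \<ge> 0" by (simp add: x_def)
  have "(x + 1/2) ^ 5 \<le> (x + 1) ^ 5"
    using x by (intro power_mono) auto
  also have "\<dots> = (x + 1) * (x + 1) ^ 4" by (simp add: eval_nat_numeral)
  also have "\<dots> \<le> (4 * (x + 1)) * (x + real k + 1) ^ 4"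
    using x by (intro mult_mono power_mono) auto
  finally have le: "(x + 1/2) ^ 5 / (4 * (x + 1) * (x + real k + 1) ^ 4) \<le> 1"
    using x by (simp add: divide_le_eq_1)
  have "\<bar>wz_base (Suc (Suc n)) k\<bar>
      = \<bar>wz_base (Suc n) k\<bar> * ((x + 1/2) ^ 5 / (4 * (x + 1) * (x + real k + 1) ^ 4))"
    unfolding wz_base_Suc_left[of "Suc n"] x_def[symmetric] using x by (simp add: abs_mult)
  also have "\<dots> \<le> \<bar>wz_base (Suc n) k\<bar> * 1"
    using le by (intro mult_left_mono) auto
  finally show ?case using Suc by simp
qed

lemma correction_tendsto_0: "correction \<longlonglongrightarrow> 0"
proof (rule Lim_null_comparison)
  show "(\<lambda>n. 6144 * ((1/1024) ^ n * real n ^ 5)) \<longlonglongrightarrow> 0"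
    by real_asymp
  show "eventually (\<lambda>n. norm (correction n) \<le> 6144 * ((1/1024) ^ n * real n ^ 5)) sequentially"
    using eventually_gt_at_top[of 0]
  proof eventually_elim
    case (elim n)
    have "pochhammer (1/2 :: real) n ^ 5 \<le> fact n ^ 5"
      by (intro power_mono pochhammer_half_le_fact pochhammer_nonneg) auto
    moreover have nn: "pochhammer (1/2 :: real) n \<ge> 0" by (intro pochhammer_nonneg) auto
    ultimately have "(1/1024) ^ n * (pochhammer (1/2) n ^ 5 / fact n ^ 5) \<le> (1/1024 :: real) ^ n * 1"
      by (intro mult_left_mono) auto
    moreover have "\<bar>wz_base n n\<bar> = (1/1024) ^ n * (pochhammer (1/2) n ^ 5 / fact n ^ 5)"
      using nn by (simp add: wz_base_diag abs_mult power_abs)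
    ultimately have b: "\<bar>wz_base n n\<bar> \<le> (1/1024) ^ n" by simp
    have q: "1 \<le> 2 * real n - 1" using elim by simp
    then have d: "1 \<le> (2 * real n - 1) ^ 3" by (rule one_le_power)
    have a: "\<bar>2 * real n - 1\<bar> = 2 * real n - 1" using q by linarith
    have "norm (correction n) = 6144 * (\<bar>wz_base n n\<bar> * real n ^ 5) / (2 * real n - 1) ^ 3"
      by (simp add: correction_def abs_mult power_abs a)
    also have "\<dots> \<le> 6144 * (\<bar>wz_base n n\<bar> * real n ^ 5) / 1"
      using d q by (intro divide_left_mono) auto
    also have "\<dots> \<le> 6144 * ((1/1024) ^ n * real n ^ 5)"
      using b by (simp add: mult_right_mono)
    finally show ?case .
  qed
qed

text \<open>
  The left side is the reciprocal of the partial Wallis product, because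
  \<open>4 k^2 - 1 = (2 k - 1) (2 k + 1)\<close> and the factors \<open>2 k - 1\<close> and \<open>2 k + 1\<close> agree up to a shift.
\<close>

lemma pochhammer_half_wallis:
  "(\<lambda>k. (pochhammer (1/2) k / fact k) ^ 2 * (2 * real k + 1)) \<longlonglongrightarrow> 2 / pi"
proof -
  have "(pochhammer (1/2) n / fact n) ^ 2 * (2 * real n + 1)
      = inverse (\<Prod>k=1..n. (4 * real k ^ 2) / (4 * real k ^ 2 - 1))" for n
  proof (induction n)
    case 0
    then show ?case by simp
  next
    case (Suc n)
    define x where "x = real n"
    define P where "P = (\<Prod>k=1..n. (4 * real k ^ 2) / (4 * real k ^ 2 - 1))"
    have x: "x + 1 \<noteq> 0" "2 * x + 1 \<noteq> 0" unfolding x_def by linarith+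
    have "(pochhammer (1/2) (Suc n) / fact (Suc n)) ^ 2 * (2 * real (Suc n) + 1)
      = ((pochhammer (1/2) n / fact n) ^ 2 * (2 * x + 1)) * ((2 * x + 1) * (2 * x + 3) / (4 * (x + 1) ^ 2))"
      using x by (simp add: pochhammer_Suc x_def[symmetric] power_divide power_mult_distrib)
        (simp add: field_simps power2_eq_square)
    also have "\<dots> = inverse P * ((2 * x + 1) * (2 * x + 3) / (4 * (x + 1) ^ 2))"
      using Suc by (simp add: P_def x_def)
    also have "(2 * x + 1) * (2 * x + 3) = 4 * real (Suc n) ^ 2 - 1"
      by (simp add: x_def algebra_simps power2_eq_square)
    also have "inverse P * ((4 * real (Suc n) ^ 2 - 1) / (4 * (x + 1) ^ 2))
      = inverse (P * ((4 * real (Suc n) ^ 2) / (4 * real (Suc n) ^ 2 - 1)))"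
    proof -
      have "x + 1 = real (Suc n)" by (simp add: x_def)
      then show ?thesis by (simp only: inverse_mult_distrib inverse_divide)
    qed
    finally show ?case by (simp add: P_def)
  qed
  moreover have "(\<lambda>n. inverse (\<Prod>k=1..n. (4 * real k ^ 2) / (4 * real k ^ 2 - 1))) \<longlonglongrightarrow> inverse (pi / 2)"
    by (intro tendsto_inverse wallis) auto
  ultimately show ?thesis by simp
qed

lemma wz_G_0_tendsto: "wz_G 0 \<longlonglongrightarrow> 8 / pi\<^sup>2"
proof -
  define W where "W = (\<lambda>k. (pochhammer (1/2) k / fact k) ^ 2 * (2 * real k + 1))"
  have "(\<lambda>k. (8 * real k ^ 2 + 4 * real k + 1) / (2 * real k + 1) ^ 2) \<longlonglongrightarrow> 2"
    by real_asymp
  then have "(\<lambda>k. W k ^ 2 * ((8 * real k ^ 2 + 4 * real k + 1) / (2 * real k + 1) ^ 2))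
      \<longlonglongrightarrow> (2 / pi) ^ 2 * 2"
    using pochhammer_half_wallis unfolding W_def by (intro tendsto_mult tendsto_power)
  moreover have "W k ^ 2 * ((8 * real k ^ 2 + 4 * real k + 1) / (2 * real k + 1) ^ 2) = wz_G 0 k" for k
  proof -
    have "2 * real k + 1 \<noteq> 0" by linarith
    moreover have "(a ^ 2 * c) ^ 2 * (m / c ^ 2) = a ^ 4 * m" if "c \<noteq> 0" for a c m :: real
      using that by (simp add: power_mult_distrib)
    ultimately have "W k ^ 2 * ((8 * real k ^ 2 + 4 * real k + 1) / (2 * real k + 1) ^ 2)
        = (pochhammer (1/2) k / fact k) ^ 4 * (8 * real k ^ 2 + 4 * real k + 1)"
      unfolding W_def by blast
    then show ?thesis
      by (simp add: wz_G_def wz_base_def power_divide algebra_simps)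
  qed
  ultimately show ?thesis by (simp add: power_divide)
qed

text \<open>
  For \<open>n < k\<close> the polynomial in \<open>wz_G\<close> is at most a multiple of \<open>(k + 1) ^ 2\<close>, so two of the four
  powers of \<open>k + 1\<close> gained by \<open>wz_base\<close> remain.
\<close>

lemma abs_wz_G_Suc_le:
  assumes "n < k"
  shows "\<bar>wz_G (Suc n) k\<bar> \<le> 65 / (real k + 1) ^ 2"
proof -
  define x y where "x = real (Suc n)" and "y = real k"
  define p where "p = 20 * x ^ 2 + 8 * x + 1 + 24 * y * x + 8 * y ^ 2 + 4 * y"
  have x: "0 \<le> x" "x \<le> y" using assms by (auto simp: x_def y_def)
  have sq: "x ^ 2 \<le> y ^ 2" "y * x \<le> y ^ 2"
    using x by (auto simp: power2_eq_square intro: mult_mono)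
  have "(y + 1) ^ 2 = y ^ 2 + 2 * y + 1" by (simp add: power2_sum)
  moreover have "p = 20 * x ^ 2 + 8 * x + 1 + 24 * (y * x) + 8 * y ^ 2 + 4 * y"
    by (simp add: p_def)
  ultimately have "p \<le> 65 * (y + 1) ^ 2"
    using x sq zero_le_power2[of y] by linarith
  moreover have "0 \<le> p" using x unfolding p_def by simp
  ultimately have "\<bar>wz_base (Suc n) k\<bar> * \<bar>p\<bar> \<le> 1 / (y + 1) ^ 4 * (65 * (y + 1) ^ 2)"
    using abs_wz_base_Suc_le[of n k] unfolding y_def by (intro mult_mono) auto
  also have "\<dots> = 65 / (y + 1) ^ 2"
  proof -
    have "1 / c ^ 4 * (65 * c ^ 2) = 65 / c ^ 2" for c :: real
      by (cases "c = 0") (simp_all add: eval_nat_numeral)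
    then show ?thesis .
  qed
  finally show ?thesis by (simp add: wz_G_def p_def x_def y_def abs_mult)
qed

lemma sum_wz_G_tendsto: "(\<lambda>N. \<Sum>n<N. wz_G n N) \<longlonglongrightarrow> 8 / pi\<^sup>2"
proof (rule LIMSEQ_imp_Suc)
  have "(\<lambda>N. \<Sum>n<N. wz_G (Suc n) (Suc N)) \<longlonglongrightarrow> 0"
  proof (rule Lim_null_comparison)
    show "(\<lambda>N. real N * (65 / (real (Suc N) + 1) ^ 2)) \<longlonglongrightarrow> 0"
      by real_asymp
    have "norm (\<Sum>n<N. wz_G (Suc n) (Suc N)) \<le> real N * (65 / (real (Suc N) + 1) ^ 2)" for N
    proof -
      have "norm (\<Sum>n<N. wz_G (Suc n) (Suc N)) \<le> (\<Sum>n<N. 65 / (real (Suc N) + 1) ^ 2)"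
        by (rule sum_norm_le) (auto intro!: abs_wz_G_Suc_le simp del: of_nat_Suc)
      then show ?thesis by simp
    qed
    then show "eventually (\<lambda>N. norm (\<Sum>n<N. wz_G (Suc n) (Suc N)) \<le> real N * (65 / (real (Suc N) + 1) ^ 2)) sequentially"
      by simp
  qed
  then have "(\<lambda>N. wz_G 0 (Suc N) + (\<Sum>n<N. wz_G (Suc n) (Suc N))) \<longlonglongrightarrow> 8 / pi\<^sup>2 + 0"
    by (intro tendsto_add LIMSEQ_Suc wz_G_0_tendsto)
  then show "(\<lambda>N. \<Sum>n<Suc N. wz_G n (Suc N)) \<longlonglongrightarrow> 8 / pi\<^sup>2"
    unfolding sum.lessThan_Suc_shift by simp
qed

theorem mainTheorem4:
  shows "(\<lambda>k::nat. (- 1 / 1024 :: real) ^ k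
            * ((pochhammer (- 1 / 2) k) ^ 3 * (pochhammer (1 / 2) k) ^ 2 / (pochhammer 1 k) ^ 5)
            * (6560 * real k ^ 5 - 528 * real k ^ 4 + 176 * real k ^ 3
               + 8 * real k ^ 2 - 6 * real k - 1))
         sums (- (8 / pi\<^sup>2))"
  unfolding series_term_def[symmetric] sums_def sum_series_term
  using tendsto_diff[OF correction_tendsto_0 sum_wz_G_tendsto] by simp

end
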